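(* Let $U$ be a unicyclic graph and let $\tau$ be a 2-switch on $U$ that removes two disjoint edges $e_1,e_2$ of $U$. Then: (1) If $e_1,e_2\in E(\operatorname{For}(U))$, then $\tau(U)$ is unicyclic if and only if, for every $e\in E(\operatorname{Cyc}(U))$, $\tau$ (viewed as a 2-switch on the tree $U-e$) is a t-switch on $U-e$. (2) If $e_1\in E(\operatorname{Cyc}(U))$ and $e_2\in E(\operatorname{For}(U))$, then $\tau(U)$ is unicyclic. (3) If $e_1,e_2\in E(\operatorname{Cyc}(U))$, then $\tau(U)$ is unicyclic if and only if $\tau(\operatorname{Cyc}(U))$ is isomorphic to $\operatorname{Cyc}(U)$.
   Context: Graphs are finite and simple. A unicyclic graph is a connected graph with exactly one cycle. A 2-switch on $G$ is specified by four distinct vertices $a,b,c,d$ with $ab,cd\in E(G)$ and $ac,bd\notin E(G)$; it produces $\tau(G)=G-ab-cd+ac+bd$, and we say it removes $ab$ and $cd$. For a graph $G$, $\operatorname{Cyc}(G)$ is the subgraph of $G$ induced by all vertices lying on some cycle of $G$, and $\operatorname{For}(G)=G-E(\operatorname{Cyc}(G))$. A 2-switch $\tau$ on a tree $T$ is a t-switch if $\tau(T)$ is a tree. *)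

theory Defs
  imports "Graph_Theory.Graph_Theory"
begin

text \<open>
  Finite simple graphs are the library's \<^const>\<open>pair_graph\<close>s: every undirected edge
  \<open>uv\<close> is represented by the two arcs \<open>(u, v)\<close> and \<open>(v, u)\<close>. The library's
  \<^const>\<open>pre_digraph.cycle\<close> is a directed notion, under which \<open>[(u, v), (v, u)]\<close> is a
  cycle, so its \<^const>\<open>forest\<close> and \<^const>\<open>tree\<close> are unsuitable for symmetric digraphs.
  Undirected cycles are those of length at least 3, and two cycles are identified when
  they form the same subgraph, i.e. regardless of starting point and orientation.
\<close>

definition edges :: "'a pair_pre_digraph \<Rightarrow> 'a set set" where
  "edges G = (\<lambda>(u, v). {u, v}) ` parcs G"

definition del_edges :: "'a pair_pre_digraph \<Rightarrow> 'a set set \<Rightarrow> 'a pair_pre_digraph" where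
  "del_edges G F = G\<lparr>parcs := {(u, v) \<in> parcs G. {u, v} \<notin> F}\<rparr>"

definition add_edges :: "'a pair_pre_digraph \<Rightarrow> 'a set set \<Rightarrow> 'a pair_pre_digraph" where
  "add_edges G F = G\<lparr>parcs := parcs G \<union> {(u, v). {u, v} \<in> F}\<rparr>"

definition walk_subgraph :: "('a \<times> 'a) awalk \<Rightarrow> 'a pair_pre_digraph" where
  "walk_subgraph p = \<lparr>pverts = fst ` set p \<union> snd ` set p, parcs = set p \<union> (set p)\<inverse>\<rparr>"

definition cycle_subgraphs :: "'a pair_pre_digraph \<Rightarrow> 'a pair_pre_digraph set" where
  "cycle_subgraphs G =
    {walk_subgraph p | p. pre_digraph.cycle (with_proj G) p \<and> 3 \<le> length p}"

definition unicyclic :: "'a pair_pre_digraph \<Rightarrow> bool" where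
  "unicyclic G \<longleftrightarrow>
    pair_graph G \<and> connected (with_proj G) \<and> (\<exists>!C. C \<in> cycle_subgraphs G)"

definition undirected_tree :: "'a pair_pre_digraph \<Rightarrow> bool" where
  "undirected_tree G \<longleftrightarrow>
    pair_graph G \<and> connected (with_proj G) \<and> cycle_subgraphs G = {}"

definition Cyc :: "'a pair_pre_digraph \<Rightarrow> 'a pair_pre_digraph" where
  "Cyc G = (let S = \<Union> (pverts ` cycle_subgraphs G)
            in \<lparr>pverts = S, parcs = {(u, v) \<in> parcs G. u \<in> S \<and> v \<in> S}\<rparr>)"

lemma with_proj_Cyc:
  "with_proj (Cyc G) = induce_subgraph (with_proj G) (\<Union> (pverts ` cycle_subgraphs G))"
  by (auto simp: Cyc_def Let_def induce_subgraph_def with_proj_def)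

definition For :: "'a pair_pre_digraph \<Rightarrow> 'a pair_pre_digraph" where
  "For G = del_edges G (edges (Cyc G))"

definition two_switch :: "'a pair_pre_digraph \<Rightarrow> 'a \<Rightarrow> 'a \<Rightarrow> 'a \<Rightarrow> 'a \<Rightarrow> bool" where
  "two_switch G a b c d \<longleftrightarrow> distinct [a, b, c, d] \<and>
    {a, b} \<in> edges G \<and> {c, d} \<in> edges G \<and> {a, c} \<notin> edges G \<and> {b, d} \<notin> edges G"

definition apply_switch ::
    "'a \<Rightarrow> 'a \<Rightarrow> 'a \<Rightarrow> 'a \<Rightarrow> 'a pair_pre_digraph \<Rightarrow> 'a pair_pre_digraph" where
  "apply_switch a b c d G = add_edges (del_edges G {{a, b}, {c, d}}) {{a, c}, {b, d}}"

lemma pair_graph_apply_switch: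
  assumes "pair_graph G" "two_switch G a b c d"
  shows "pair_graph (apply_switch a b c d G)"
proof -
  interpret pair_graph G by fact
  have V: "a \<in> pverts G" "b \<in> pverts G" "c \<in> pverts G" "d \<in> pverts G"
    using assms(2) by (auto simp: two_switch_def edges_def doubleton_eq_iff dest: wellformed')
  have fin: "finite (parcs (apply_switch a b c d G))"
    by (rule finite_subset[of _ "parcs G \<union> {a, b, c, d} \<times> {a, b, c, d}"])
      (auto simp: apply_switch_def add_edges_def del_edges_def doubleton_eq_iff)
  show ?thesis
    using assms(2) V pair_finite_verts fin pair_sym_arcs
    by unfold_locales
      (auto simp: apply_switch_def add_edges_def del_edges_def two_switch_def
        doubleton_eq_iff symmetric_def sym_def insert_commute dest: wellformed' no_loops)
qed

definition t_switch :: "'a pair_pre_digraph \<Rightarrow> 'a \<Rightarrow> 'a \<Rightarrow> 'a \<Rightarrow> 'a \<Rightarrow> bool" where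
  "t_switch T a b c d \<longleftrightarrow>
    undirected_tree T \<and> two_switch T a b c d \<and> undirected_tree (apply_switch a b c d T)"

end

theory Submission
  imports Defs
begin

text \<open>
  An edge lies on a cycle iff its ends remain connected after deleting it. Hence deleting an
  edge of the unique cycle leaves a tree, and adding an edge to a tree creates exactly one
  cycle. In case (1) the cycle survives the switch, which commutes with deleting a cycle edge.
  Otherwise let \<open>ab\<close> be on the cycle. Then \<open>U - ab\<close> is a tree, and \<open>U - ab - cd\<close> has two components;
  if \<open>b\<close> lies on the side of \<open>c\<close>, adding \<open>bd\<close> gives a tree again, and \<open>ac\<close> closes one cycle. In case
  (2) \<open>a\<close> and \<open>b\<close> lie on the same side, so this works up to renaming. In case (3) the two
  removed edges cut the cycle into arcs \<open>P\<close> (starting at \<open>b\<close>) and \<open>Q\<close> (ending at \<open>a\<close>):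
  if \<open>P\<close> ends at \<open>c\<close>, the switch reverses \<open>P\<close> inside the cycle; if \<open>P\<close> ends at \<open>d\<close>, it
  closes \<open>P\<close> and \<open>Q\<close> separately and disconnects both the cycle and \<open>U\<close>.
\<close>

subsection \<open>Cycles as vertex lists\<close>

definition path_arcs :: "'a list \<Rightarrow> 'a rel" where
  "path_arcs xs = set (zip xs (tl xs))"

text \<open>For the empty list \<open>last\<close> and \<open>hd\<close> are unspecified, and so is
  the closing arc; hence the nonemptiness hypotheses in later lemmas.\<close>

definition ring_arcs :: "'a list \<Rightarrow> 'a rel" where
  "ring_arcs xs = (let R = insert (last xs, hd xs) (path_arcs xs) in R \<union> R\<inverse>)"

definition ring :: "'a list \<Rightarrow> 'a pair_pre_digraph" where
  "ring xs = \<lparr>pverts = set xs, parcs = ring_arcs xs\<rparr>"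

lemma path_arcs_simps [simp]:
  "path_arcs [] = {}"
  "path_arcs [x] = {}"
  "path_arcs (x # y # zs) = insert (x, y) (path_arcs (y # zs))"
  by (auto simp: path_arcs_def)

lemma path_arcs_Cons: "xs \<noteq> [] \<Longrightarrow> path_arcs (x # xs) = insert (x, hd xs) (path_arcs xs)"
  by (cases xs) auto

lemma path_arcs_append:
  "xs \<noteq> [] \<Longrightarrow> ys \<noteq> [] \<Longrightarrow>
    path_arcs (xs @ ys) = insert (last xs, hd ys) (path_arcs xs \<union> path_arcs ys)"
  by (induction xs rule: induct_list012) (auto simp: path_arcs_Cons)

lemma path_arcs_rev: "path_arcs (rev xs) = (path_arcs xs)\<inverse>"
proof (induction xs)
  case (Cons x xs)
  then show ?case
    by (cases "xs = []") (auto simp: path_arcs_append path_arcs_Cons last_rev)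
qed simp

lemma path_arcs_subset: "path_arcs xs \<subseteq> set xs \<times> set xs"
  by (induction xs rule: induct_list012) auto

lemma path_arcs_map: "path_arcs (map f xs) = map_prod f f ` path_arcs xs"
  by (induction xs rule: induct_list012) auto

lemma path_arcs_split: "(x, y) \<in> path_arcs xs \<Longrightarrow> \<exists>as bs. xs = as @ x # y # bs"
proof (induction xs rule: induct_list012)
  case (3 u v zs)
  then show ?case
    by (metis append_Cons append_Nil insertE path_arcs_simps(3) prod.inject)
qed auto

lemma path_arcs_connect: "xs \<noteq> [] \<Longrightarrow> (hd xs, last xs) \<in> (path_arcs xs)\<^sup>*"
proof (induction xs rule: induct_list012)
  case (3 x y zs)
  then have "(y, last (y # zs)) \<in> (path_arcs (x # y # zs))\<^sup>*"
    by (auto intro: rtrancl_mono[THEN subsetD])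
  then show ?case by (auto intro: converse_rtrancl_into_rtrancl)
qed auto

text \<open>The path is built from its far end by prepending vertices. If the new vertex already
  lies on the path, the path is cut back to its suffix from there, which keeps it simple.\<close>

lemma rtrancl_imp_distinct_path:
  assumes "(x, y) \<in> R\<^sup>*"
  shows "\<exists>xs. xs \<noteq> [] \<and> distinct xs \<and> hd xs = x \<and> last xs = y \<and> path_arcs xs \<subseteq> R"
  using assms
proof (induction rule: converse_rtrancl_induct)
  case base
  show ?case by (rule exI[of _ "[y]"]) simp
next
  case (step x z)
  then obtain xs where xs: "xs \<noteq> []" "distinct xs" "hd xs = z" "last xs = y" "path_arcs xs \<subseteq> R"
    by blast
  show ?case
  proof (cases "x \<in> set xs")
    case True
    then obtain as bs where "xs = as @ x # bs" by (meson split_list)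
    with xs show ?thesis
      by (intro exI[of _ "x # bs"]) (cases "as = []"; auto simp: path_arcs_append)
  next
    case False
    with xs step show ?thesis
      by (intro exI[of _ "x # xs"]) (auto simp: path_arcs_Cons)
  qed
qed

section \<open>Rings: rotation, reversal, opening at an arc\<close>

lemma ring_simps [simp]:
  "pverts (ring xs) = set xs"
  "parcs (ring xs) = ring_arcs xs"
  by (simp_all add: ring_def)

lemma ring_arcs_sym: "(x, y) \<in> ring_arcs xs \<longleftrightarrow> (y, x) \<in> ring_arcs xs"
  by (auto simp: ring_arcs_def Let_def)

lemma path_arcs_subset_ring_arcs: "path_arcs xs \<subseteq> ring_arcs xs"
  by (auto simp: ring_arcs_def Let_def)

lemma ring_arcs_append:
  assumes "xs \<noteq> []" "ys \<noteq> []"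
  shows "ring_arcs (xs @ ys) = (let R = {(last xs, hd ys), (last ys, hd xs)} \<union> path_arcs xs \<union> path_arcs ys
    in R \<union> R\<inverse>)"
  using assms by (auto simp: ring_arcs_def Let_def path_arcs_append)

text \<open>For nonempty parts, the closing arc of one list is the inner junction of the
  other.\<close>

lemma ring_rotate: "ring (xs @ ys) = ring (ys @ xs)"
proof (cases "xs = [] \<or> ys = []")
  case False
  then show ?thesis by (auto simp: ring_def ring_arcs_append Let_def)
qed auto

lemma ring_rev: "ring (rev xs) = ring xs"
  by (cases "xs = []") (auto simp: ring_def ring_arcs_def Let_def path_arcs_rev hd_rev last_rev)

lemma ring_arcs_in_verts:
  assumes "xs \<noteq> []" "(x, y) \<in> ring_arcs xs"
  shows "x \<in> set xs" "y \<in> set xs"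
  using assms path_arcs_subset[of xs] by (auto simp: ring_arcs_def Let_def)

text \<open>Rotation moves the chosen arc to the closing position; an arc that runs against the list
  is treated by reversing the list first. The length bound leaves at least one inner vertex.\<close>

lemma ring_open_at_arc:
  assumes "distinct xs" "3 \<le> length xs" "(x, y) \<in> ring_arcs xs"
  shows "\<exists>zs. zs \<noteq> [] \<and> distinct (y # zs @ [x]) \<and> ring (y # zs @ [x]) = ring xs"
proof -
  have forward: "\<exists>zs. zs \<noteq> [] \<and> distinct (y # zs @ [x]) \<and> ring (y # zs @ [x]) = ring xs"
    if xs: "distinct xs" "3 \<le> length xs" "(x, y) \<in> insert (last xs, hd xs) (path_arcs xs)" for x y xs
  proof (cases "(x, y) \<in> path_arcs xs")
    case True
    then obtain as bs where split: "xs = as @ x # y # bs" using path_arcs_split by fast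
    have "ring (y # bs @ as @ [x]) = ring xs"
      using ring_rotate[of "y # bs" "as @ [x]"] by (simp add: split)
    then show ?thesis using xs(1,2) split
      by (intro exI[of _ "bs @ as"]) auto
  next
    \<comment> \<open>Here the arc is the closing one, so \<open>xs\<close> itself already runs from
      \<open>y\<close> to \<open>x\<close>.\<close>
    case False
    obtain ys where ys: "xs = y # ys" using xs False by (cases xs) auto
    obtain zs where "ys = zs @ [x]" using xs False ys by (cases ys rule: rev_cases) auto
    with ys xs show ?thesis by (intro exI[of _ zs]) auto
  qed
  show ?thesis
  proof (cases "(x, y) \<in> insert (last xs, hd xs) (path_arcs xs)")
    case True
    then show ?thesis using forward[OF assms(1,2)] by simp
  next
    case False
    then have "(x, y) \<in> insert (last (rev xs), hd (rev xs)) (path_arcs (rev xs))"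
      using assms by (auto simp: ring_arcs_def Let_def path_arcs_rev hd_rev last_rev)
    then show ?thesis using forward[of "rev xs" x y] assms by (simp add: ring_rev)
  qed
qed

text \<open>Opened at the arc, the ring becomes a path between its ends. This path has an inner
  vertex and no repetition, so it never steps directly between \<open>x\<close> and
  \<open>y\<close>.\<close>

lemma ring_arc_bypass:
  assumes "distinct xs" "3 \<le> length xs" "(x, y) \<in> ring_arcs xs"
  shows "(x, y) \<in> (ring_arcs xs - {(x, y), (y, x)})\<^sup>*"
proof -
  \<comment> \<open>Opening at the reversed arc makes the path run from \<open>x\<close> to
    \<open>y\<close>.\<close>
  have "(y, x) \<in> ring_arcs xs" using assms(3) by (simp add: ring_arcs_sym)
  from ring_open_at_arc[OF assms(1,2) this] obtain zs where
    zs: "zs \<noteq> []" "distinct (x # zs @ [y])" "ring (x # zs @ [y]) = ring xs" by blast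
  have "(x, y) \<notin> path_arcs (x # zs @ [y])" "(y, x) \<notin> path_arcs (x # zs @ [y])"
    using zs(1,2) path_arcs_subset[of "zs"]
    by (auto simp: path_arcs_Cons path_arcs_append)
  moreover have "path_arcs (x # zs @ [y]) \<subseteq> ring_arcs xs"
    using path_arcs_subset_ring_arcs[of "x # zs @ [y]"] zs(3) by (metis ring_simps(2))
  ultimately have "path_arcs (x # zs @ [y]) \<subseteq> ring_arcs xs - {(x, y), (y, x)}" by blast
  from rtrancl_mono[OF this] show ?thesis
    using path_arcs_connect[of "x # zs @ [y]"] by auto
qed

text \<open>A prefix of the list is a path from \<open>hd xs\<close> to any given entry; symmetry of
  the arcs lets two such paths be joined at \<open>hd xs\<close>.\<close>

lemma ring_connected:
  assumes "u \<in> set xs" "v \<in> set xs"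
  shows "(u, v) \<in> (ring_arcs xs)\<^sup>*"
proof -
  have "(hd xs, w) \<in> (ring_arcs xs)\<^sup>*" if w: "w \<in> set xs" for w
  proof -
    obtain as bs where xs: "xs = as @ w # bs" using w by (meson split_list)
    have "path_arcs (as @ [w]) \<subseteq> path_arcs xs"
      using path_arcs_append[of "as @ [w]" bs] by (cases "bs = []") (auto simp: xs)
    then have "path_arcs (as @ [w]) \<subseteq> ring_arcs xs" using path_arcs_subset_ring_arcs by blast
    from rtrancl_mono[OF this] show ?thesis
      using path_arcs_connect[of "as @ [w]"] by (cases as) (auto simp: xs)
  qed
  moreover have "sym ((ring_arcs xs)\<^sup>*)" by (intro sym_rtrancl symI) (simp add: ring_arcs_sym)
  ultimately show ?thesis using assms by (meson rtrancl_trans symD)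
qed

text \<open>The arcs of a ring depend only on positions in the list, so matching the entries
  position by position is an isomorphism.\<close>

lemma ring_iso:
  assumes "distinct xs" "distinct ys" "length xs = length ys" "xs \<noteq> []"
  shows "digraph_iso (with_proj (ring xs)) (with_proj (ring ys))"
proof -
  define f where "f = (\<lambda>x. the (map_of (zip xs ys) x))"
  have map_f: "map f xs = ys"
    using assms by (intro nth_equalityI) (auto simp: f_def map_of_zip_nth)
  have inj: "inj_on f (set xs)" using assms map_f distinct_map by blast
  define h where "h = \<lparr>iso_verts = f, iso_arcs = map_prod f f, iso_head = snd, iso_tail = fst\<rparr>"
  have arcs: "ring_arcs ys = map_prod f f ` ring_arcs xs"
    unfolding map_f[symmetric] ring_arcs_def Let_def path_arcs_map
    using assms(4) by (auto simp: hd_map last_map image_iff)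
  have "inj_on (map_prod f f) (set xs \<times> set xs)" using inj by (simp add: map_prod_inj_on)
  moreover have "ring_arcs xs \<subseteq> set xs \<times> set xs" using ring_arcs_in_verts[OF assms(4)] by auto
  ultimately have "inj_on (map_prod f f) (ring_arcs xs)" by (rule inj_on_subset)
  moreover have "wf_digraph (with_proj (ring xs))"
    using ring_arcs_in_verts[OF assms(4)] by unfold_locales auto
  ultimately have "pre_digraph.digraph_isomorphism (with_proj (ring xs)) h"
    using inj by (auto simp: pre_digraph.digraph_isomorphism_def h_def)
  moreover have "with_proj (ring ys) = app_iso h (with_proj (ring xs))"
    using map_f arcs by (auto simp: app_iso_def h_def with_proj_def)
  ultimately show ?thesis unfolding digraph_iso_def by blast
qed

lemma pair_graph_ring:
  assumes "distinct xs" "2 \<le> length xs"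
  shows "pair_graph (ring xs)"
proof -
  have "xs \<noteq> []" using assms by auto
  have "x \<noteq> y" if "(x, y) \<in> path_arcs xs" for x y
    using path_arcs_split[OF that] assms by auto
  moreover have "last xs \<noteq> hd xs" using assms by (cases xs) auto
  ultimately have "x \<noteq> y" if "(x, y) \<in> ring_arcs xs" for x y
    using that by (auto simp: ring_arcs_def Let_def)
  moreover have "finite (ring_arcs xs)" by (simp add: ring_arcs_def path_arcs_def Let_def)
  ultimately show ?thesis
    using ring_arcs_in_verts[OF \<open>xs \<noteq> []\<close>]
    by unfold_locales (auto simp: symmetric_def intro!: symI dest: ring_arcs_sym[THEN iffD1])
qed

section \<open>From arc walks to vertex lists\<close>

lemma pcas_conv_verts: "pcas u p v \<longleftrightarrow> u # map snd p = map fst p @ [v]"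
  by (induction p arbitrary: u) auto

lemma pawalk_verts_eq: "pcas u p v \<Longrightarrow> pawalk_verts u p = u # map snd p"
  by (induction p arbitrary: u) auto

lemma pcas_arcs: "pcas u p v \<Longrightarrow> set p = path_arcs (map fst p @ [v])"
proof (induction p arbitrary: u)
  case (Cons e p)
  then show ?case by (cases p; cases e) auto
qed simp

text \<open>Along a closed walk the heads are the tails rotated by one place, so the list of tails
  determines all vertices and arcs.\<close>

lemma walk_subgraph_closed:
  assumes "pcas u p u" "p \<noteq> []"
  shows "walk_subgraph p = ring (map fst p)"
proof -
  let ?xs = "map fst p"
  have eq: "u # map snd p = ?xs @ [u]" using assms by (simp add: pcas_conv_verts)
  have hd: "hd ?xs = u" using eq assms(2) by (cases p) auto
  have "set p = insert (last ?xs, hd ?xs) (path_arcs ?xs)"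
    using hd assms(2) by (simp add: pcas_arcs[OF assms(1)] path_arcs_append)
  moreover have "set (map snd p) = set ?xs"
  proof -
    have "map snd p = rotate1 ?xs" using eq assms(2) by (cases p) auto
    then show ?thesis by (metis set_rotate1)
  qed
  ultimately show ?thesis by (auto simp: walk_subgraph_def ring_def ring_arcs_def Let_def)
qed

text \<open>A cycle is read off by its arc tails; conversely, pairing a list with its rotation gives
  an arc walk. This bridge lets all later arguments use vertex lists.\<close>

lemma cycle_subgraphs_eq:
  assumes "pair_graph G"
  shows "cycle_subgraphs G = {ring xs | xs. distinct xs \<and> 3 \<le> length xs \<and> ring_arcs xs \<subseteq> parcs G}"
    (is "_ = ?R")
proof -
  interpret pair_graph G by fact
  have cycle_iff: "pre_digraph.cycle (with_proj G) p \<longleftrightarrow>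
      (\<exists>u. u \<in> pverts G \<and> set p \<subseteq> parcs G \<and> pcas u p u \<and> distinct (map snd p) \<and> p \<noteq> [])" for p
    unfolding pre_digraph.cycle_def pre_digraph.awalk_def
    by (auto simp: cas_with_proj_eq awalk_verts_with_proj_eq pawalk_verts_eq)
  \<comment> \<open>Cycles ask for distinct heads, rings for distinct tails; on a closed walk both
    lists form the same multiset.\<close>
  have distinct: "distinct (map snd p) \<longleftrightarrow> distinct (map fst p)" if "pcas u p u" for u and p :: "('a \<times> 'a) list"
  proof -
    have "mset (u # map snd p) = mset (map fst p @ [u])" using that by (simp add: pcas_conv_verts)
    then show ?thesis by (simp add: mset_eq_imp_distinct_iff)
  qed
  show ?thesis
  proof (intro equalityI subsetI)
    fix C assume "C \<in> cycle_subgraphs G"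
    then obtain p u where p: "C = walk_subgraph p" "3 \<le> length p" "set p \<subseteq> parcs G" "pcas u p u"
      "distinct (map snd p)" "p \<noteq> []"
      by (auto simp: cycle_subgraphs_def cycle_iff)
    have C: "C = ring (map fst p)" using walk_subgraph_closed[OF p(4,6)] p(1) by simp
    have "parcs C \<subseteq> parcs G" using p(1,3) by (auto simp: walk_subgraph_def intro: arcs_symmetric)
    then have "ring_arcs (map fst p) \<subseteq> parcs G" using C by simp
    then show "C \<in> ?R" using C p distinct[OF p(4)] by auto
  next
    fix C assume "C \<in> ?R"
    then obtain xs where xs: "C = ring xs" "distinct xs" "3 \<le> length xs" "ring_arcs xs \<subseteq> parcs G"
      by blast
    define p where "p = zip xs (tl xs @ [hd xs])"
    have len: "length p = length xs" using xs(3) by (simp add: p_def)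
    have fst: "map fst p = xs" and snd: "map snd p = tl xs @ [hd xs]"
      using xs(3) by (simp_all add: p_def)
    have "xs \<noteq> []" "p \<noteq> []" using xs(3) len by auto
    then have cas: "pcas (hd xs) p (hd xs)" by (simp add: pcas_conv_verts fst snd)
    have C: "C = walk_subgraph p" using walk_subgraph_closed[OF cas] fst \<open>p \<noteq> []\<close> xs(1) by simp
    then have "set p \<subseteq> parcs C" by (auto simp: walk_subgraph_def)
    then have sub: "set p \<subseteq> parcs G" using xs by auto
    have "hd p \<in> set p" using \<open>p \<noteq> []\<close> by simp
    moreover have "fst (hd p) = hd xs" using fst \<open>p \<noteq> []\<close> by (metis hd_map)
    ultimately have "hd xs \<in> pverts G" using sub arc_fst_in_verts by (metis subsetD)
    then have "pre_digraph.cycle (with_proj G) p"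
      using cycle_iff sub cas distinct[OF cas] fst xs(2) \<open>p \<noteq> []\<close> by auto
    then show "C \<in> cycle_subgraphs G" using C xs(3) len by (auto simp: cycle_subgraphs_def)
  qed
qed


subsection \<open>Cycles, bridges and trees\<close>

lemma pair_graph_sym_parcs: "pair_graph G \<Longrightarrow> sym (parcs G)"
  by (meson pair_graph_def pair_pseudo_graph_def pair_sym_digraph.arcs_symmetric symI)

text \<open>The arcs are already symmetric and stay inside the vertex set, so neither the symmetric
  closure nor the restriction to \<open>pverts G\<close> changes reachability.\<close>

lemma pair_graph_connected_iff:
  assumes "pair_graph G"
  shows "connected (with_proj G) \<longleftrightarrow>
    pverts G \<noteq> {} \<and> (\<forall>u \<in> pverts G. \<forall>v \<in> pverts G. (u, v) \<in> (parcs G)\<^sup>*)"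
proof -
  interpret pair_graph G by fact
  have "(parcs G)\<^sup>s = parcs G" by (auto simp: symcl_def arcs_symmetric)
  moreover have "(u, v) \<in> rtrancl_on (pverts G) (parcs G) \<longleftrightarrow> (u, v) \<in> (parcs G)\<^sup>*"
    if "u \<in> pverts G" for u v
    using reachable_conv'[OF that, of v] by (simp add: reachable_def)
  ultimately show ?thesis by (auto simp: connected_conv)
qed

section \<open>Deleting and adding one edge\<close>

lemma parcs_del_edge [simp]: "parcs (del_edges G {{x, y}}) = parcs G - {(x, y), (y, x)}"
  by (auto simp: del_edges_def doubleton_eq_iff)

lemma pverts_del_edges [simp]: "pverts (del_edges G F) = pverts G"
  by (simp add: del_edges_def)

lemma parcs_add_edge [simp]: "parcs (add_edges G {{x, y}}) = parcs G \<union> {(x, y), (y, x)}"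
  by (auto simp: add_edges_def doubleton_eq_iff)

lemma pverts_add_edges [simp]: "pverts (add_edges G F) = pverts G"
  by (simp add: add_edges_def)

lemma pair_graph_del_edge:
  assumes "pair_graph G"
  shows "pair_graph (del_edges G {{x, y}})"
proof -
  interpret pair_graph G by fact
  show ?thesis
    using pair_finite_verts pair_finite_arcs wellformed' no_loops'
    by unfold_locales (auto simp: symmetric_def sym_def dest: arcs_symmetric)
qed

lemma pair_graph_add_edge:
  assumes "pair_graph G" "x \<in> pverts G" "y \<in> pverts G" "x \<noteq> y"
  shows "pair_graph (add_edges G {{x, y}})"
proof -
  interpret pair_graph G by fact
  show ?thesis
    using assms(2-4) pair_finite_verts pair_finite_arcs wellformed' no_loops'
    by unfold_locales (auto simp: symmetric_def sym_def dest: arcs_symmetric)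
qed

lemma in_edges_iff:
  assumes "pair_graph G"
  shows "{x, y} \<in> edges G \<longleftrightarrow> (x, y) \<in> parcs G"
proof -
  have "{x, y} \<in> edges G \<longleftrightarrow> (x, y) \<in> parcs G \<or> (y, x) \<in> parcs G"
    by (force simp: edges_def doubleton_eq_iff)
  then show ?thesis using pair_graph_sym_parcs[OF assms] by (meson symD)
qed

section \<open>Cycles as subgraphs\<close>

lemma cycle_subgraphsE:
  assumes "pair_graph G" "C \<in> cycle_subgraphs G"
  obtains xs where "C = ring xs" "distinct xs" "3 \<le> length xs" "ring_arcs xs \<subseteq> parcs G"
  using assms(2) unfolding cycle_subgraphs_eq[OF assms(1)] by blast

lemma cycle_subgraph_arcs_subset:
  "pair_graph G \<Longrightarrow> C \<in> cycle_subgraphs G \<Longrightarrow> parcs C \<subseteq> parcs G"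
  by (erule cycle_subgraphsE) auto

text \<open>By \<open>cycle_subgraphs_eq\<close> the ambient graph enters only through containing
  the arcs of the ring.\<close>

lemma cycle_subgraph_transfer:
  assumes "pair_graph G" "pair_graph H" "C \<in> cycle_subgraphs G" "parcs C \<subseteq> parcs H"
  shows "C \<in> cycle_subgraphs H"
proof -
  from assms(1,3) obtain xs where "C = ring xs" "distinct xs" "3 \<le> length xs"
    by (rule cycle_subgraphsE)
  then show ?thesis using assms(2,4) cycle_subgraphs_eq by auto
qed

lemma cycle_subgraph_bypass:
  assumes "pair_graph G" "C \<in> cycle_subgraphs G" "(x, y) \<in> parcs C"
  shows "(x, y) \<in> (parcs C - {(x, y), (y, x)})\<^sup>*"
proof -
  from assms(1,2) obtain xs where "C = ring xs" "distinct xs" "3 \<le> length xs"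
    by (rule cycle_subgraphsE)
  then show ?thesis using assms(3) ring_arc_bypass by auto
qed

lemma cycle_subgraph_arcs_nonempty:
  assumes "pair_graph G" "C \<in> cycle_subgraphs G"
  obtains x y where "(x, y) \<in> parcs C"
proof -
  from assms obtain xs where "C = ring xs"
    by (rule cycle_subgraphsE)
  then show ?thesis using that[of "last xs" "hd xs"] by (simp add: ring_arcs_def Let_def)
qed

lemma cycle_subgraph_sym:
  assumes "pair_graph G" "C \<in> cycle_subgraphs G"
  shows "(x, y) \<in> parcs C \<longleftrightarrow> (y, x) \<in> parcs C"
proof -
  from assms obtain xs where "C = ring xs" by (rule cycle_subgraphsE)
  then show ?thesis using ring_arcs_sym by simp
qed

lemma cycle_subgraph_verts:
  assumes "pair_graph G" "C \<in> cycle_subgraphs G"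
  shows "pverts C = fst ` parcs C"
proof -
  from assms obtain xs where xs: "C = ring xs" "3 \<le> length xs"
    by (rule cycle_subgraphsE)
  then have ne: "xs \<noteq> []" by auto
  have "u \<in> fst ` ring_arcs xs" if u: "u \<in> set xs" for u
  proof -
    obtain as bs where split: "xs = as @ u # bs" using u by (meson split_list)
    \<comment> \<open>The successor of \<open>u\<close> on the ring, which wraps around to
      \<open>hd xs\<close> at the end of the list.\<close>
    have "(u, if bs = [] then hd xs else hd bs) \<in> ring_arcs xs"
    proof (cases "bs = []")
      case False
      then have "(u, hd bs) \<in> path_arcs xs"
        using path_arcs_append[of "as @ [u]" bs] by (simp add: split)
      then show ?thesis using False path_arcs_subset_ring_arcs by auto
    qed (simp add: split ring_arcs_def Let_def)
    then show ?thesis by force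
  qed
  moreover have "fst ` ring_arcs xs \<subseteq> set xs" using ring_arcs_in_verts[OF ne] by auto
  ultimately show ?thesis using xs(1) by auto
qed

lemma cycle_subgraph_eqI:
  assumes "pair_graph G" "C \<in> cycle_subgraphs G" "D \<in> cycle_subgraphs G" "parcs C = parcs D"
  shows "C = D"
  using assms cycle_subgraph_verts[OF assms(1,2)] cycle_subgraph_verts[OF assms(1,3)]
  by (intro pair_pre_digraph.equality) auto

text \<open>A simple path that joins the ends and avoids the edge is closed by it to a cycle. With
  at most two vertices the path would force a loop or be the edge itself.\<close>

lemma cycle_through_arc:
  assumes "pair_graph G" "(x, y) \<in> parcs G" "(x, y) \<in> (parcs G - {(x, y), (y, x)})\<^sup>*"
  shows "\<exists>C \<in> cycle_subgraphs G. (x, y) \<in> parcs C"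
proof -
  interpret pair_graph G by fact
  from rtrancl_imp_distinct_path[OF assms(3)] obtain xs where
    xs: "xs \<noteq> []" "distinct xs" "hd xs = x" "last xs = y"
      "path_arcs xs \<subseteq> parcs G - {(x, y), (y, x)}"
    by blast
  have "x \<noteq> y" using assms(2) no_loops' by blast
  have "3 \<le> length xs"
  proof (rule ccontr)
    assume "\<not> 3 \<le> length xs"
    then consider u where "xs = [u]" | u v where "xs = [u, v]"
      using xs(1) by (cases xs; cases "tl xs"; cases "tl (tl xs)") auto
    then show False using xs \<open>x \<noteq> y\<close> by cases auto
  qed
  moreover have "ring_arcs xs \<subseteq> parcs G"
    using xs assms(2) arcs_symmetric by (auto simp: ring_arcs_def Let_def)
  ultimately have "ring xs \<in> cycle_subgraphs G"
    using xs(2) cycle_subgraphs_eq[OF assms(1)] by auto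
  moreover have "(x, y) \<in> ring_arcs xs" using xs(3,4) by (simp add: ring_arcs_def Let_def)
  ultimately show ?thesis by force
qed

lemma tree_arc_is_bridge:
  assumes "undirected_tree T" "(x, y) \<in> parcs T"
  shows "(x, y) \<notin> (parcs T - {(x, y), (y, x)})\<^sup>*"
  using cycle_through_arc[OF _ assms(2)] assms(1) by (auto simp: undirected_tree_def)

text \<open>Suppose an edge \<open>f\<close> of the first cycle is missing from the second. The rest of the
  first cycle joins the ends of \<open>f\<close>, and its use of \<open>xy\<close> can be replaced by the rest of the
  second cycle, so \<open>f\<close> lies on a cycle avoiding \<open>xy\<close>.\<close>

lemma cycle_subgraphs_through_eq:
  assumes G: "pair_graph G"
    and acyclic: "cycle_subgraphs (del_edges G {{x, y}}) = {}"
    and C: "C \<in> cycle_subgraphs G" "(x, y) \<in> parcs C"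
    and D: "D \<in> cycle_subgraphs G" "(x, y) \<in> parcs D"
  shows "C = D"
proof -
  have "parcs C \<subseteq> parcs D"
    if C: "C \<in> cycle_subgraphs G" "(x, y) \<in> parcs C" and D: "D \<in> cycle_subgraphs G" "(x, y) \<in> parcs D"
    for C D
  proof (intro subrelI, rule ccontr)
    fix u v assume uv: "(u, v) \<in> parcs C" "(u, v) \<notin> parcs D"
    let ?H = "del_edges G {{x, y}}"
    let ?R = "parcs ?H - {(u, v), (v, u)}"
    have H: "pair_graph ?H" by (rule pair_graph_del_edge[OF G])
    have vu: "(v, u) \<notin> parcs D" using uv(2) cycle_subgraph_sym[OF G D(1)] by blast
    have "parcs D - {(x, y), (y, x)} \<subseteq> ?R"
      using cycle_subgraph_arcs_subset[OF G D(1)] uv(2) vu by auto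
    then have xy: "(x, y) \<in> ?R\<^sup>*"
      using cycle_subgraph_bypass[OF G D] rtrancl_mono by blast
    have "sym (?R\<^sup>*)"
      using pair_graph_sym_parcs[OF H] by (intro sym_rtrancl) (auto simp: sym_def)
    then have yx: "(y, x) \<in> ?R\<^sup>*" using xy by (meson symD)
    have "parcs C - {(u, v), (v, u)} \<subseteq> ?R\<^sup>*"
      using cycle_subgraph_arcs_subset[OF G C(1)] xy yx by auto
    then have "(u, v) \<in> ?R\<^sup>*"
      using cycle_subgraph_bypass[OF G C(1) uv(1)] rtrancl_subset_rtrancl by blast
    moreover have "(u, v) \<in> parcs ?H"
      using uv C D cycle_subgraph_arcs_subset[OF G C(1)] vu cycle_subgraph_sym[OF G D(1)] by auto
    ultimately show False using cycle_through_arc[OF H] acyclic by blast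
  qed
  then show ?thesis using cycle_subgraph_eqI[OF G] C D by blast
qed

text \<open>The tree path from \<open>x\<close> to \<open>y\<close> closes up with the new edge. A
  cycle without that edge would lie in the tree, so all cycles pass through it and
  \<open>cycle_subgraphs_through_eq\<close> identifies them.\<close>

lemma unicyclic_add_edge:
  assumes tree: "undirected_tree T"
    and xy: "x \<in> pverts T" "y \<in> pverts T" "x \<noteq> y" "(x, y) \<notin> parcs T"
  shows "unicyclic (add_edges T {{x, y}})"
proof -
  let ?G = "add_edges T {{x, y}}"
  have T: "pair_graph T" "connected (with_proj T)" "cycle_subgraphs T = {}"
    using tree by (auto simp: undirected_tree_def)
  have G: "pair_graph ?G" using pair_graph_add_edge T(1) xy(1-3) .
  have yx: "(y, x) \<notin> parcs T" using xy(4) pair_graph_sym_parcs[OF T(1)] by (meson symD)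
  have reach: "(u, v) \<in> (parcs T)\<^sup>*" if "u \<in> pverts T" "v \<in> pverts T" for u v
    using T(1,2) that by (simp add: pair_graph_connected_iff)
  have "(u, v) \<in> (parcs ?G)\<^sup>*" if "u \<in> pverts T" "v \<in> pverts T" for u v
    using reach[OF that] rtrancl_mono[of "parcs T" "parcs ?G"] by auto
  then have "connected (with_proj ?G)" using xy(1) by (auto simp: pair_graph_connected_iff[OF G])
  moreover have del: "del_edges ?G {{x, y}} = T"
    using xy(4) yx by (intro pair_pre_digraph.equality) auto
  have "(x, y) \<in> (parcs ?G - {(x, y), (y, x)})\<^sup>*"
    using reach[OF xy(1,2)] arg_cong[OF del, of parcs] by simp
  then obtain C where C: "C \<in> cycle_subgraphs ?G" "(x, y) \<in> parcs C"
    using cycle_through_arc[OF G, of x y] by auto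
  have "D = C" if D: "D \<in> cycle_subgraphs ?G" for D
  proof -
    have "(x, y) \<in> parcs D"
    proof (rule ccontr)
      assume "(x, y) \<notin> parcs D"
      moreover from this have "(y, x) \<notin> parcs D" using cycle_subgraph_sym[OF G D] by blast
      ultimately have "parcs D \<subseteq> parcs T" using cycle_subgraph_arcs_subset[OF G D] by auto
      then show False using cycle_subgraph_transfer[OF G T(1) D] T(3) by blast
    qed
    then show ?thesis using cycle_subgraphs_through_eq[OF G _ D _ C] del T(3) by simp
  qed
  ultimately show ?thesis using G C(1) unfolding unicyclic_def by blast
qed

text \<open>\<open>Cyc\<close> is an induced subgraph, so the point is that the only cycle has no
  chord: its ends are already joined along the cycle, so a chord would lie on a second
  cycle.\<close>

lemma unicyclic_Cyc:
  assumes "unicyclic U"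
  shows "cycle_subgraphs U = {Cyc U}"
proof -
  have U: "pair_graph U" using assms by (simp add: unicyclic_def)
  obtain C where C: "cycle_subgraphs U = {C}" using assms by (auto simp: unicyclic_def)
  then have C': "C \<in> cycle_subgraphs U" by simp
  then obtain xs where xs: "C = ring xs" using U by (meson cycle_subgraphsE)
  have "(u, v) \<in> parcs C" if uv: "(u, v) \<in> parcs U" "u \<in> pverts C" "v \<in> pverts C" for u v
  proof (rule ccontr)
    assume notin: "(u, v) \<notin> parcs C"
    then have "(v, u) \<notin> parcs C" using cycle_subgraph_sym[OF U C'] by blast
    then have "parcs C \<subseteq> parcs U - {(u, v), (v, u)}"
      using notin cycle_subgraph_arcs_subset[OF U C'] by auto
    moreover have "(u, v) \<in> (parcs C)\<^sup>*" using ring_connected uv(2,3) by (simp add: xs)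
    ultimately have "(u, v) \<in> (parcs U - {(u, v), (v, u)})\<^sup>*" using rtrancl_mono by blast
    from cycle_through_arc[OF U uv(1) this] C notin show False by auto
  qed
  moreover have "u \<in> pverts C \<and> v \<in> pverts C" if "(u, v) \<in> parcs C" for u v
    using that cycle_subgraph_sym[OF U C'] cycle_subgraph_verts[OF U C'] by force
  ultimately have "Cyc U = C"
    using cycle_subgraph_arcs_subset[OF U C'] C
    by (intro pair_pre_digraph.equality) (auto simp: Cyc_def Let_def)
  then show ?thesis using C by simp
qed

text \<open>The rest of the cycle replaces the deleted edge, which preserves connectedness. A
  surviving cycle would be a cycle of \<open>U\<close>, hence \<open>Cyc U\<close>, which uses that
  edge.\<close>

lemma tree_del_cycle_edge:
  assumes "unicyclic U" "(x, y) \<in> parcs (Cyc U)"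
  shows "undirected_tree (del_edges U {{x, y}})"
proof -
  let ?T = "del_edges U {{x, y}}"
  have U: "pair_graph U" "connected (with_proj U)" using assms by (simp_all add: unicyclic_def)
  have T: "pair_graph ?T" by (rule pair_graph_del_edge[OF U(1)])
  note cyc = unicyclic_Cyc[OF assms(1)]
  then have C: "Cyc U \<in> cycle_subgraphs U" by simp
  have "parcs (Cyc U) - {(x, y), (y, x)} \<subseteq> parcs ?T"
    using cycle_subgraph_arcs_subset[OF U(1) C] by auto
  then have xy: "(x, y) \<in> (parcs ?T)\<^sup>*"
    using cycle_subgraph_bypass[OF U(1) C assms(2)] rtrancl_mono by blast
  then have "(y, x) \<in> (parcs ?T)\<^sup>*"
    using pair_graph_sym_parcs[OF T] by (meson symD sym_rtrancl)
  with xy have "parcs U \<subseteq> (parcs ?T)\<^sup>*" by auto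
  then have "(parcs U)\<^sup>* \<subseteq> (parcs ?T)\<^sup>*" by (rule rtrancl_subset_rtrancl)
  then have "connected (with_proj ?T)"
    using U(2) unfolding pair_graph_connected_iff[OF U(1)] pair_graph_connected_iff[OF T] by auto
  moreover have "cycle_subgraphs ?T = {}"
  proof (rule ccontr)
    assume "cycle_subgraphs ?T \<noteq> {}"
    then obtain D where D: "D \<in> cycle_subgraphs ?T" by blast
    have sub: "parcs D \<subseteq> parcs ?T" by (rule cycle_subgraph_arcs_subset[OF T D])
    then have "D \<in> cycle_subgraphs U" using cycle_subgraph_transfer[OF T U(1) D] by auto
    then have "D = Cyc U" using cyc by simp
    then show False using sub assms(2) by auto
  qed
  ultimately show ?thesis using T by (simp add: undirected_tree_def)
qed

text \<open>Without the bridge \<open>cd\<close> the tree falls into the side of \<open>c\<close>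
  and the side of \<open>d\<close>. Since \<open>x\<close> and \<open>y\<close> lie on different
  sides, \<open>xy\<close> is a bridge that rejoins them.\<close>

lemma tree_exchange_edge:
  assumes tree: "undirected_tree T" and cd: "(c, d) \<in> parcs T"
    and xc: "(x, c) \<in> (parcs T - {(c, d), (d, c)})\<^sup>*"
    and yd: "(y, d) \<in> (parcs T - {(c, d), (d, c)})\<^sup>*"
  shows "undirected_tree (add_edges (del_edges T {{c, d}}) {{x, y}})"
proof -
  let ?F = "del_edges T {{c, d}}"
  let ?G = "add_edges ?F {{x, y}}"
  have T: "pair_graph T" "connected (with_proj T)" "cycle_subgraphs T = {}"
    using tree by (auto simp: undirected_tree_def)
  interpret pair_graph T by fact
  have F: "pair_graph ?F" by (rule pair_graph_del_edge[OF T(1)])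
  have symF: "sym ((parcs ?F)\<^sup>*)" using pair_graph_sym_parcs[OF F] by (rule sym_rtrancl)
  have xcF: "(x, c) \<in> (parcs ?F)\<^sup>*" and ydF: "(y, d) \<in> (parcs ?F)\<^sup>*" using xc yd by simp_all
  have sep: "(x, y) \<notin> (parcs ?F)\<^sup>*"
  proof
    assume "(x, y) \<in> (parcs ?F)\<^sup>*"
    then have "(c, d) \<in> (parcs ?F)\<^sup>*" using symF xcF ydF by (meson rtrancl_trans symD)
    then show False using tree_arc_is_bridge[OF tree cd] by simp
  qed
  have V: "x \<in> pverts T" "y \<in> pverts T"
    using xc yd cd wellformed' by (auto elim: converse_rtranclE)
  have "x \<noteq> y" using sep by auto
  have G: "pair_graph ?G" using V \<open>x \<noteq> y\<close> by (intro pair_graph_add_edge F) simp_all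
  have symG: "sym ((parcs ?G)\<^sup>*)" using pair_graph_sym_parcs[OF G] by (rule sym_rtrancl)
  have FG: "(parcs ?F)\<^sup>* \<subseteq> (parcs ?G)\<^sup>*" by (intro rtrancl_mono) auto
  have "(x, y) \<in> (parcs ?G)\<^sup>*" by auto
  \<comment> \<open>The detour from \<open>c\<close> through \<open>x\<close> and \<open>y\<close>
    to \<open>d\<close> replaces the removed edge.\<close>
  then have cdG: "(c, d) \<in> (parcs ?G)\<^sup>*" using symG xcF ydF FG by (meson rtrancl_trans subsetD symD)
  then have "(d, c) \<in> (parcs ?G)\<^sup>*" using symG by (meson symD)
  with cdG have "parcs T \<subseteq> (parcs ?G)\<^sup>*" by auto
  then have "(parcs T)\<^sup>* \<subseteq> (parcs ?G)\<^sup>*" by (rule rtrancl_subset_rtrancl)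
  then have "connected (with_proj ?G)"
    using T(2) unfolding pair_graph_connected_iff[OF T(1)] pair_graph_connected_iff[OF G] by auto
  moreover have "cycle_subgraphs ?G = {}"
  proof (rule ccontr)
    assume "cycle_subgraphs ?G \<noteq> {}"
    then obtain C where C: "C \<in> cycle_subgraphs ?G" by blast
    note sub = cycle_subgraph_arcs_subset[OF G C]
    show False
    proof (cases "(x, y) \<in> parcs C")
      case True
      \<comment> \<open>The rest of such a cycle would join \<open>x\<close> to \<open>y\<close>
        inside \<open>?F\<close>, against \<open>sep\<close>.\<close>
      have "parcs C - {(x, y), (y, x)} \<subseteq> parcs ?F" using sub by auto
      then show False using cycle_subgraph_bypass[OF G C True] sep rtrancl_mono by blast
    next
      case False
      then have "(y, x) \<notin> parcs C" using cycle_subgraph_sym[OF G C] by blast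
      with False sub have "parcs C \<subseteq> parcs T" by auto
      then show False using cycle_subgraph_transfer[OF G T(1) C] T(3) by blast
    qed
  qed
  ultimately show ?thesis using G by (simp add: undirected_tree_def)
qed


subsection \<open>Two-switches\<close>

lemma parcs_apply_switch:
  "parcs (apply_switch a b c d G) =
    parcs G - {(a, b), (b, a), (c, d), (d, c)} \<union> {(a, c), (c, a), (b, d), (d, b)}"
  by (auto simp: apply_switch_def add_edges_def del_edges_def doubleton_eq_iff)

lemma pverts_apply_switch [simp]: "pverts (apply_switch a b c d G) = pverts G"
  by (simp add: apply_switch_def)

text \<open>A switch has two symmetries: exchanging the two removed edges, and reversing both, which
  exchanges the two added edges. They provide the renamings in case (2).\<close>

lemma apply_switch_commute: "apply_switch c d a b G = apply_switch a b c d G"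
  by (intro pair_pre_digraph.equality) (auto simp: parcs_apply_switch)

lemma apply_switch_flip: "apply_switch b a d c G = apply_switch a b c d G"
  by (intro pair_pre_digraph.equality) (auto simp: parcs_apply_switch)

lemma two_switch_commute: "two_switch G c d a b \<longleftrightarrow> two_switch G a b c d"
  by (auto simp: two_switch_def insert_commute)

lemma two_switch_flip: "two_switch G b a d c \<longleftrightarrow> two_switch G a b c d"
  by (auto simp: two_switch_def insert_commute)

lemma two_switch_iff:
  assumes "pair_graph G"
  shows "two_switch G a b c d \<longleftrightarrow> distinct [a, b, c, d] \<and>
    (a, b) \<in> parcs G \<and> (c, d) \<in> parcs G \<and> (a, c) \<notin> parcs G \<and> (b, d) \<notin> parcs G"
  unfolding two_switch_def using in_edges_iff[OF assms] by simp

text \<open>The cycle survives in \<open>?W\<close>, and deleting one of its edges before or after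
  the switch gives the same graph. So the claim compares \<open>?W\<close> with the graphs obtained
  from it by deleting an edge of that cycle.\<close>

lemma unicyclic_switch_off_cycle:
  assumes U: "unicyclic U" and switch: "two_switch U a b c d"
    and off: "(a, b) \<notin> parcs (Cyc U)" "(c, d) \<notin> parcs (Cyc U)"
  shows "unicyclic (apply_switch a b c d U) \<longleftrightarrow>
    (\<forall>e \<in> edges (Cyc U). t_switch (del_edges U {e}) a b c d)"
proof -
  let ?W = "apply_switch a b c d U"
  have G: "pair_graph U" using U by (simp add: unicyclic_def)
  have W: "pair_graph ?W" using pair_graph_apply_switch[OF G switch] .
  have C: "Cyc U \<in> cycle_subgraphs U" using unicyclic_Cyc[OF U] by simp
  note C_sub = cycle_subgraph_arcs_subset[OF G C]
  note C_sym = cycle_subgraph_sym[OF G C]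
  note sw = switch[unfolded two_switch_iff[OF G]]
  note U_sym = symD[OF pair_graph_sym_parcs[OF G]]
  have CW: "parcs (Cyc U) \<subseteq> parcs ?W"
    using C_sub C_sym off by (auto simp: parcs_apply_switch)
  have new: "(a, c) \<notin> parcs U" "(c, a) \<notin> parcs U" "(b, d) \<notin> parcs U" "(d, b) \<notin> parcs U"
    using sw U_sym by blast+
  \<comment> \<open>The two operations commute because \<open>xy\<close> is an edge of
    \<open>U\<close>, while the added edges are not.\<close>
  have del: "apply_switch a b c d (del_edges U {{x, y}}) = del_edges ?W {{x, y}}"
    if "(x, y) \<in> parcs (Cyc U)" for x y
  proof -
    have "(x, y) \<in> parcs U" "(y, x) \<in> parcs U" using that C_sub C_sym by auto
    then show ?thesis
      using new by (intro pair_pre_digraph.equality) (auto simp: parcs_apply_switch)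
  qed
  show ?thesis
  proof
    assume uni: "unicyclic ?W"
    have "Cyc U \<in> cycle_subgraphs ?W" using cycle_subgraph_transfer[OF G W C CW] .
    then have cyc: "Cyc ?W = Cyc U" using unicyclic_Cyc[OF uni] by simp
    show "\<forall>e \<in> edges (Cyc U). t_switch (del_edges U {e}) a b c d"
    proof
      fix e assume "e \<in> edges (Cyc U)"
      then obtain x y where e: "e = {x, y}" and xy: "(x, y) \<in> parcs (Cyc U)"
        by (auto simp: edges_def)
      have yx: "(y, x) \<in> parcs (Cyc U)" using xy C_sym by blast
      have T: "undirected_tree (del_edges U {{x, y}})" by (rule tree_del_cycle_edge[OF U xy])
      then have PT: "pair_graph (del_edges U {{x, y}})" by (simp add: undirected_tree_def)
      have "two_switch (del_edges U {{x, y}}) a b c d"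
        using sw off xy yx by (auto simp: two_switch_iff[OF PT])
      moreover have "undirected_tree (apply_switch a b c d (del_edges U {{x, y}}))"
        using tree_del_cycle_edge[OF uni] xy cyc by (simp add: del)
      ultimately show "t_switch (del_edges U {e}) a b c d" using T by (simp add: t_switch_def e)
    qed
  next
    assume t: "\<forall>e \<in> edges (Cyc U). t_switch (del_edges U {e}) a b c d"
    \<comment> \<open>One cycle edge is enough: removing it from \<open>?W\<close> leaves a tree,
      and putting it back closes exactly one cycle.\<close>
    obtain x y where xy: "(x, y) \<in> parcs (Cyc U)"
      using cycle_subgraph_arcs_nonempty[OF G C] .
    then have "{x, y} \<in> edges (Cyc U)" by (auto simp: edges_def)
    then have tree: "undirected_tree (del_edges ?W {{x, y}})"
      using t xy del by (auto simp: t_switch_def)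
    have xyW: "(x, y) \<in> parcs ?W" "(y, x) \<in> parcs ?W" using CW C_sym xy by auto
    have "x \<in> pverts ?W" "y \<in> pverts ?W" "x \<noteq> y"
      using W xyW(1)
      by (auto simp: pair_graph_def pair_digraph_def pair_fin_digraph_def
        pair_loopfree_digraph_def pair_loopfree_digraph_axioms_def
        dest: pair_wf_digraph.wellformed' simp del: pverts_apply_switch)
    then have "unicyclic (add_edges (del_edges ?W {{x, y}}) {{x, y}})"
      by (intro unicyclic_add_edge[OF tree]) auto
    moreover have "add_edges (del_edges ?W {{x, y}}) {{x, y}} = ?W"
      using xyW by (intro pair_pre_digraph.equality) auto
    ultimately show "unicyclic ?W" by simp
  qed
qed

text \<open>The common core of cases (2) and (3): delete \<open>ab\<close>, exchange
  \<open>cd\<close> for \<open>bd\<close>, then add \<open>ac\<close>. The hypothesis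
  \<open>reach\<close> places \<open>b\<close> on the side of \<open>c\<close>, as the exchange
  requires.\<close>

lemma unicyclic_switch_if_reconnects:
  assumes U: "unicyclic U" and switch: "two_switch U a b c d"
    and ab: "(a, b) \<in> parcs (Cyc U)"
    and reach: "(b, c) \<in> (parcs U - {(a, b), (b, a), (c, d), (d, c)})\<^sup>*"
  shows "unicyclic (apply_switch a b c d U)"
proof -
  have G: "pair_graph U" using U by (simp add: unicyclic_def)
  interpret pair_graph U by fact
  note sw = switch[unfolded two_switch_iff[OF G]]
  have new: "(a, c) \<notin> parcs U" "(c, a) \<notin> parcs U" "(b, d) \<notin> parcs U" "(d, b) \<notin> parcs U"
    using sw arcs_symmetric by blast+
  let ?T = "del_edges U {{a, b}}"
  let ?S = "add_edges (del_edges ?T {{c, d}}) {{b, d}}"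
  have T: "undirected_tree ?T" by (rule tree_del_cycle_edge[OF U ab])
  have "parcs ?T - {(c, d), (d, c)} = parcs U - {(a, b), (b, a), (c, d), (d, c)}" by auto
  then have "(b, c) \<in> (parcs ?T - {(c, d), (d, c)})\<^sup>*" using reach by simp
  then have S: "undirected_tree ?S" using sw by (intro tree_exchange_edge[OF T]) auto
  have "a \<in> pverts U" "c \<in> pverts U" using sw wellformed' by blast+
  then have "unicyclic (add_edges ?S {{a, c}})"
    using sw new by (intro unicyclic_add_edge[OF S]) auto
  moreover have "add_edges ?S {{a, c}} = apply_switch a b c d U"
    by (intro pair_pre_digraph.equality) (auto simp: parcs_apply_switch)
  ultimately show ?thesis by simp
qed

text \<open>A path to \<open>c\<close> must visit \<open>c\<close> or \<open>d\<close> before it can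
  use the edge \<open>cd\<close>.\<close>

lemma rtrancl_avoid_edge:
  assumes "(u, c) \<in> R\<^sup>*"
  shows "(u, c) \<in> (R - {(c, d), (d, c)})\<^sup>* \<or> (u, d) \<in> (R - {(c, d), (d, c)})\<^sup>*"
  using assms
proof (induction rule: converse_rtrancl_induct)
  case (step y z)
  show ?case
  proof (cases "(y, z) \<in> R - {(c, d), (d, c)}")
    case True
    then show ?thesis using step.IH by (meson converse_rtrancl_into_rtrancl)
  next
    case False
    then show ?thesis using step.hyps(1) by auto
  qed
qed simp

lemma unicyclic_switch_mixed:
  assumes U: "unicyclic U" and switch: "two_switch U a b c d"
    and ab: "(a, b) \<in> parcs (Cyc U)" and cd: "(c, d) \<notin> parcs (Cyc U)"
  shows "unicyclic (apply_switch a b c d U)"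
proof -
  have G: "pair_graph U" using U by (simp add: unicyclic_def)
  interpret pair_graph U by fact
  have C: "Cyc U \<in> cycle_subgraphs U" using unicyclic_Cyc[OF U] by simp
  note C_sub = cycle_subgraph_arcs_subset[OF G C]
  note C_sym = cycle_subgraph_sym[OF G C]
  note sw = switch[unfolded two_switch_iff[OF G]]
  let ?T = "del_edges U {{a, b}}"
  let ?R = "parcs U - {(a, b), (b, a), (c, d), (d, c)}"
  have T: "undirected_tree ?T" by (rule tree_del_cycle_edge[OF U ab])
  have "(d, c) \<notin> parcs (Cyc U)" using cd C_sym by blast
  then have "parcs (Cyc U) - {(a, b), (b, a)} \<subseteq> ?R" using C_sub cd by auto
  \<comment> \<open>The cycle does not use \<open>cd\<close>, so \<open>a\<close> and
    \<open>b\<close> stay on the same side of it.\<close>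
  then have abR: "(a, b) \<in> ?R\<^sup>*" using cycle_subgraph_bypass[OF G C ab] rtrancl_mono by blast
  have "b \<in> pverts ?T" "c \<in> pverts ?T" using sw wellformed' by auto
  then have "(b, c) \<in> (parcs ?T)\<^sup>*"
    using T pair_graph_connected_iff[of ?T] by (auto simp: undirected_tree_def)
  then have "(b, c) \<in> (parcs ?T - {(c, d), (d, c)})\<^sup>* \<or> (b, d) \<in> (parcs ?T - {(c, d), (d, c)})\<^sup>*"
    by (rule rtrancl_avoid_edge)
  moreover have "parcs ?T - {(c, d), (d, c)} = ?R" by auto
  ultimately have "(b, c) \<in> ?R\<^sup>* \<or> (b, d) \<in> ?R\<^sup>*" by simp
  then show ?thesis
  proof
    assume "(b, c) \<in> ?R\<^sup>*"
    then show ?thesis using unicyclic_switch_if_reconnects[OF U switch ab] by simp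
  next
    assume "(b, d) \<in> ?R\<^sup>*"
    \<comment> \<open>After the renaming that reverses both edges, this is the reachability needed
      by the core lemma.\<close>
    with abR have "(a, d) \<in> ?R\<^sup>*" by (rule rtrancl_trans)
    moreover have "?R = parcs U - {(b, a), (a, b), (d, c), (c, d)}" by auto
    ultimately have "unicyclic (apply_switch b a d c U)"
      using switch ab C_sym
      by (intro unicyclic_switch_if_reconnects[OF U]) (auto simp: two_switch_flip)
    then show ?thesis by (simp add: apply_switch_flip)
  qed
qed

text \<open>The switch removes the two junctions between \<open>xs\<close> and \<open>ys\<close>;
  the two added edges are the junctions of \<open>rev xs\<close> with \<open>ys\<close>.\<close>

lemma apply_switch_ring:
  assumes "distinct (xs @ ys)" "xs \<noteq> []" "ys \<noteq> []"
  shows "apply_switch (last ys) (hd xs) (last xs) (hd ys) (ring (xs @ ys)) = ring (rev xs @ ys)"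
proof -
  have "hd xs \<in> set xs" "last xs \<in> set xs" "hd ys \<in> set ys" "last ys \<in> set ys"
    using assms by simp_all
  \<comment> \<open>The removed arcs cross between the two disjoint parts, so the arcs inside each
    part survive.\<close>
  then have "{(last ys, hd xs), (hd xs, last ys), (last xs, hd ys), (hd ys, last xs)}
      \<inter> (path_arcs xs \<union> path_arcs ys) = {}"
    using assms(1) path_arcs_subset[of xs] path_arcs_subset[of ys] by auto
  then show ?thesis
    using assms(2,3)
    by (intro pair_pre_digraph.equality)
      (auto simp: parcs_apply_switch ring_arcs_append Let_def path_arcs_rev hd_rev last_rev)
qed

text \<open>Traverse the cycle from \<open>b\<close> to \<open>a\<close> without using
  \<open>ab\<close>: if \<open>c\<close> comes before \<open>d\<close>, both sides of the
  equivalence are true; otherwise both are false.\<close>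

lemma unicyclic_switch_on_cycle:
  assumes U: "unicyclic U" and switch: "two_switch U a b c d"
    and ab: "(a, b) \<in> parcs (Cyc U)" and cd: "(c, d) \<in> parcs (Cyc U)"
  shows "unicyclic (apply_switch a b c d U) \<longleftrightarrow>
    digraph_iso (with_proj (apply_switch a b c d (Cyc U))) (with_proj (Cyc U))"
proof -
  have G: "pair_graph U" using U by (simp add: unicyclic_def)
  interpret pair_graph U by fact
  have C: "Cyc U \<in> cycle_subgraphs U" using unicyclic_Cyc[OF U] by simp
  note C_sub = cycle_subgraph_arcs_subset[OF G C]
  note sw = switch[unfolded two_switch_iff[OF G]]
  let ?R = "parcs U - {(a, b), (b, a), (c, d), (d, c)}"
  have symR: "sym (?R\<^sup>*)" by (intro sym_rtrancl) (auto simp: sym_def arcs_symmetric)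
  from G C obtain xs where xs: "Cyc U = ring xs" "distinct xs" "3 \<le> length xs"
    by (rule cycle_subgraphsE)
  then obtain zs where zs: "distinct (b # zs @ [a])" "ring (b # zs @ [a]) = Cyc U"
    using ring_open_at_arc[of xs a b] ab by auto
  have "(c, d) \<in> ring_arcs (b # zs @ [a])" using cd zs(2) by (metis ring_simps(2))
  \<comment> \<open>The closing arc is \<open>ab\<close>, so \<open>cd\<close> lies inside the list;
    \<open>s\<close> and \<open>t\<close> below name its ends in list order.\<close>
  then have "(c, d) \<in> path_arcs (b # zs @ [a]) \<or> (d, c) \<in> path_arcs (b # zs @ [a])"
    using sw by (auto simp: ring_arcs_def Let_def)
  then obtain as bs s t where split: "b # zs @ [a] = as @ s # t # bs"
    and st: "s = c \<and> t = d \<or> s = d \<and> t = c"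
    using path_arcs_split by metis
  define P where "P = as @ [s]"
  define Q where "Q = t # bs"
  have PQ: "b # zs @ [a] = P @ Q" "P \<noteq> []" "Q \<noteq> []" by (simp_all add: P_def Q_def split)
  have ends: "last P = s" "hd Q = t" by (simp_all add: P_def Q_def)
  have hdP: "hd P = b" using PQ by (metis hd_append2 list.sel(1))
  have lastQ: "last Q = a" using PQ by (metis last_ConsR last_appendR last_snoc snoc_eq_iff_butlast)
  have dist: "distinct (P @ Q)" using zs(1) PQ(1) by simp
  have CycPQ: "Cyc U = ring (P @ Q)" using zs(2) PQ(1) by simp
  have "path_arcs P \<union> path_arcs Q \<subseteq> parcs U"
    using C_sub unfolding CycPQ by (auto simp: ring_arcs_append PQ Let_def)
  moreover have "b \<in> set P" "a \<in> set Q" "s \<in> set P" "t \<in> set Q"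
    using PQ hdP lastQ ends by (metis hd_in_set last_in_set)+
  ultimately have "path_arcs P \<union> path_arcs Q \<subseteq> ?R"
    using dist st path_arcs_subset[of P] path_arcs_subset[of Q] by auto
  then have "(path_arcs P)\<^sup>* \<subseteq> ?R\<^sup>*" "(path_arcs Q)\<^sup>* \<subseteq> ?R\<^sup>*"
    by (simp_all add: rtrancl_mono)
  then have bs: "(b, s) \<in> ?R\<^sup>*" and ta: "(t, a) \<in> ?R\<^sup>*"
    using path_arcs_connect[OF PQ(2)] path_arcs_connect[OF PQ(3)] hdP lastQ ends by auto
  from st show ?thesis
  proof
    assume "s = c \<and> t = d"
    then have s: "s = c" "t = d" by simp_all
    have "apply_switch a b c d (Cyc U) = ring (rev P @ Q)"
      using apply_switch_ring[OF dist PQ(2,3)] by (simp add: hdP lastQ ends s CycPQ)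
    moreover have "digraph_iso (with_proj (ring (rev P @ Q))) (with_proj (ring (P @ Q)))"
      using dist PQ by (intro ring_iso) auto
    moreover have "unicyclic (apply_switch a b c d U)"
      using unicyclic_switch_if_reconnects[OF U switch ab] bs s by simp
    ultimately show ?thesis by (simp add: CycPQ)
  next
    assume "s = d \<and> t = c"
    then have s: "s = d" "t = c" by simp_all
    let ?W = "apply_switch a b c d U"
    let ?D = "apply_switch a b c d (Cyc U)"
    have W: "pair_graph ?W" using pair_graph_apply_switch[OF G switch] .
    \<comment> \<open>Now \<open>ac\<close> joins the ends of \<open>Q\<close> and \<open>bd\<close>
      those of \<open>P\<close>, so the added edges create no new reachability over
      \<open>?R\<close>. A connection from \<open>a\<close> to \<open>b\<close> would therefore give
      a detour around \<open>cd\<close> in the tree \<open>U - ab\<close>.\<close>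
    have sep: "(a, b) \<notin> (parcs ?W)\<^sup>*"
    proof
      assume "(a, b) \<in> (parcs ?W)\<^sup>*"
      moreover have "parcs ?W \<subseteq> ?R\<^sup>*"
        using bs ta symR by (auto simp: parcs_apply_switch s dest: symD)
      ultimately have "(a, b) \<in> ?R\<^sup>*" using rtrancl_subset_rtrancl by blast
      then have "(c, d) \<in> ?R\<^sup>*" using bs ta s by (meson rtrancl_trans)
      moreover have "?R = parcs (del_edges U {{a, b}}) - {(c, d), (d, c)}" by auto
      ultimately show False
        using tree_arc_is_bridge[OF tree_del_cycle_edge[OF U ab], of c d] sw by auto
    qed
    have V: "a \<in> pverts (Cyc U)" "b \<in> pverts (Cyc U)"
      using \<open>a \<in> set Q\<close> \<open>b \<in> set P\<close> by (simp_all add: CycPQ)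
    have "\<not> unicyclic ?W"
      using sep sw wellformed' pair_graph_connected_iff[OF W] by (auto simp: unicyclic_def)
    moreover have "\<not> digraph_iso (with_proj ?D) (with_proj (Cyc U))"
    proof
      \<comment> \<open>An isomorphism would transport connectedness from the cycle to
        \<open>?D\<close>; but \<open>?D\<close> has its arcs in \<open>?W\<close>, where
        \<open>a\<close> and \<open>b\<close> are separated.\<close>
      assume iso: "digraph_iso (with_proj ?D) (with_proj (Cyc U))"
      have PC: "pair_graph (Cyc U)" using pair_graph_ring[of xs] xs by simp
      interpret Cy: pair_graph "Cyc U" by fact
      have "two_switch (Cyc U) a b c d"
        using sw ab cd C_sub by (auto simp: two_switch_iff[OF PC])
      then have PD: "pair_graph ?D" using pair_graph_apply_switch[OF PC] by blast
      then interpret D: pair_graph ?D .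
      have "connected (with_proj (Cyc U))"
        unfolding pair_graph_connected_iff[OF PC] using V(1) ring_connected[of _ xs] xs(1) by auto
      moreover obtain h where "Cy.digraph_isomorphism h" "with_proj ?D = app_iso h (with_proj (Cyc U))"
        using digraph_iso_swap[OF D.wf_digraph_axioms iso] unfolding digraph_iso_def by blast
      ultimately have "connected (with_proj ?D)" using Cy.connectedI_app_iso[of h] by simp
      then have "(a, b) \<in> (parcs ?D)\<^sup>*" using V by (simp add: pair_graph_connected_iff[OF PD])
      moreover have "parcs ?D \<subseteq> parcs ?W" using C_sub by (auto simp: parcs_apply_switch)
      ultimately show False using sep rtrancl_mono by blast
    qed
    ultimately show ?thesis by simp
  qed
qed

section \<open>Assembling the three cases\<close>

lemma edges_For_disjoint: "e \<in> edges (For G) \<Longrightarrow> e \<notin> edges (Cyc G)"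
  by (auto simp: For_def edges_def del_edges_def)

theorem mainTheorem4:
  fixes U :: "'a pair_pre_digraph" and a b c d :: 'a and e1 e2 :: "'a set"
  assumes "unicyclic U"
    and "two_switch U a b c d"
    and "{e1, e2} = {{a, b}, {c, d}}"
  shows "(e1 \<in> edges (For U) \<and> e2 \<in> edges (For U) \<longrightarrow>
           (unicyclic (apply_switch a b c d U) \<longleftrightarrow>
             (\<forall>e \<in> edges (Cyc U). t_switch (del_edges U {e}) a b c d)))
       \<and> (e1 \<in> edges (Cyc U) \<and> e2 \<in> edges (For U) \<longrightarrow>
           unicyclic (apply_switch a b c d U))
       \<and> (e1 \<in> edges (Cyc U) \<and> e2 \<in> edges (Cyc U) \<longrightarrow>
           (unicyclic (apply_switch a b c d U) \<longleftrightarrow>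
             digraph_iso (with_proj (apply_switch a b c d (Cyc U))) (with_proj (Cyc U))))"
proof -
  have G: "pair_graph U" using assms(1) by (simp add: unicyclic_def)
  \<comment> \<open>As a ring, \<open>Cyc U\<close> is itself a pair graph, so its edges can be
    translated into arcs.\<close>
  have "Cyc U \<in> cycle_subgraphs U" using unicyclic_Cyc[OF assms(1)] by simp
  from G this obtain xs where "Cyc U = ring xs" "distinct xs" "3 \<le> length xs"
    by (rule cycle_subgraphsE)
  then have "pair_graph (Cyc U)" using pair_graph_ring[of xs] by simp
  note edge_iff = in_edges_iff[OF this]
  have e: "e1 = {a, b} \<and> e2 = {c, d} \<or> e1 = {c, d} \<and> e2 = {a, b}"
    using assms(3) by (simp add: doubleton_eq_iff)
  have mixed: "unicyclic (apply_switch a b c d U)"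
    if "e1 \<in> edges (Cyc U)" "e2 \<in> edges (For U)"
    using e
  proof
    assume "e1 = {a, b} \<and> e2 = {c, d}"
    then show ?thesis
      using that edges_For_disjoint[of e2 U] unicyclic_switch_mixed[OF assms(1,2)]
      by (simp add: edge_iff)
  next
    \<comment> \<open>Here the cycle edge is \<open>cd\<close>, so the roles of the two removed
      edges are exchanged.\<close>
    assume "e1 = {c, d} \<and> e2 = {a, b}"
    moreover have "two_switch U c d a b" using assms(2) by (simp add: two_switch_commute)
    ultimately have "unicyclic (apply_switch c d a b U)"
      using that edges_For_disjoint[of e2 U] unicyclic_switch_mixed[OF assms(1)]
      by (simp add: edge_iff)
    then show ?thesis by (simp add: apply_switch_commute)
  qed
  moreover have "unicyclic (apply_switch a b c d U) \<longleftrightarrow>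
      (\<forall>e \<in> edges (Cyc U). t_switch (del_edges U {e}) a b c d)"
    if "e1 \<in> edges (For U)" "e2 \<in> edges (For U)"
    using e that edges_For_disjoint[of e1 U] edges_For_disjoint[of e2 U]
    by (intro unicyclic_switch_off_cycle[OF assms(1,2)]) (auto simp: edge_iff)
  moreover have "unicyclic (apply_switch a b c d U) \<longleftrightarrow>
      digraph_iso (with_proj (apply_switch a b c d (Cyc U))) (with_proj (Cyc U))"
    if "e1 \<in> edges (Cyc U)" "e2 \<in> edges (Cyc U)"
    using e that by (intro unicyclic_switch_on_cycle[OF assms(1,2)]) (auto simp: edge_iff)
  ultimately show ?thesis by blast
qed

end
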